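(* Let $a>0$. Place $n$ sensors on $[0,\infty)$ at the first $n$ arrival times $X_1\le\dots\le X_n$ of a homogeneous Poisson process on $[0,\infty)$ with rate $n$. Consider algorithm $MV_1(n,\frac1n)$: the first sensor stays at $X_1$ and, for $i=2,\dots,n$, the sensor at $X_i$ is moved to $X_1+\frac{i-1}{n}$. Then the expected $a$-total movement $\mathbf{E}\left[\sum_{i=2}^n|X_i-X_1-\frac{i-1}{n}|^a\right]$ is $O\!\left(n^{1-\frac a2}\right)$.
   Context: If the $i$-th sensor is displaced by a distance $|m(i)|$, the $a$-total movement is $\sum_{i=1}^n|m(i)|^a$. Asymptotics are as $n\to\infty$ with $a$ fixed. *)

theory Defs
  imports "HOL-Probability.Probability" "HOL-Library.Landau_Symbols"
begin

(* N t w is the number of arrivals in [0,t]; values at negative t are irrelevant.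
   Paths are nondecreasing, so the truncated subtraction of increments is exact. *)
locale poisson_process = prob_space M
  for M :: "'a measure" and rate :: real and N :: "real \<Rightarrow> 'a \<Rightarrow> nat" +
  assumes rate_pos: "rate > 0"
    and measurable_count: "0 \<le> t \<Longrightarrow> N t \<in> measurable M (count_space UNIV)"
    and count_0: "\<omega> \<in> space M \<Longrightarrow> N 0 \<omega> = 0"
    and mono_paths: "\<lbrakk>\<omega> \<in> space M; 0 \<le> s; s \<le> t\<rbrakk> \<Longrightarrow> N s \<omega> \<le> N t \<omega>"
    and right_continuous_paths:
      "\<lbrakk>\<omega> \<in> space M; 0 \<le> t\<rbrakk> \<Longrightarrow> continuous (at_right t) (\<lambda>u. N u \<omega>)"
    and independent_increments:
      "\<lbrakk>0 \<le> \<tau> 0; \<And>j. j < k \<Longrightarrow> \<tau> j \<le> \<tau> (Suc j)\<rbrakk> \<Longrightarrow>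
        indep_vars (\<lambda>_. count_space UNIV) (\<lambda>j \<omega>. N (\<tau> (Suc j)) \<omega> - N (\<tau> j) \<omega>) {..<k::nat}"
    and poisson_increments:
      "\<lbrakk>0 \<le> s; s < t\<rbrakk> \<Longrightarrow>
        distr M (count_space UNIV) (\<lambda>\<omega>. N t \<omega> - N s \<omega>) = measure_pmf (poisson_pmf (rate * (t - s)))"

(* The i-th arrival time, i \<ge> 1. The set is empty, and the infimum unspecified,
   only on paths with fewer than i arrivals in total, which form a null event. *)
definition arrival_time :: "(real \<Rightarrow> 'a \<Rightarrow> nat) \<Rightarrow> nat \<Rightarrow> 'a \<Rightarrow> real" where
  "arrival_time N i \<omega> = Inf {t. 0 \<le> t \<and> i \<le> N t \<omega>}"

(* Sensors are numbered from 1; x i is the initial and MV1 s x i the final position of sensor i. *)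
definition MV1 :: "real \<Rightarrow> (nat \<Rightarrow> real) \<Rightarrow> nat \<Rightarrow> real" where
  "MV1 s x i = (if i = 1 then x 1 else x 1 + (real i - 1) * s)"

definition total_movement :: "real \<Rightarrow> nat \<Rightarrow> (nat \<Rightarrow> real) \<Rightarrow> (nat \<Rightarrow> real) \<Rightarrow> real" where
  "total_movement a n x y = (\<Sum>i=1..n. \<bar>x i - y i\<bar> powr a)"

lemma total_movement_MV1:
  "total_movement a n x (MV1 (1 / real n) x) =
    (\<Sum>i=2..n. \<bar>x i - x 1 - (real i - 1) / real n\<bar> powr a)"
proof -
  have "total_movement a n x (MV1 (1 / real n) x) =
      (\<Sum>i=2..n. \<bar>x i - MV1 (1 / real n) x i\<bar> powr a)"
    unfolding total_movement_def
    by (rule sum.mono_neutral_right) (auto simp: MV1_def Suc_le_eq numeral_2_eq_2)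
  also have "\<dots> = (\<Sum>i=2..n. \<bar>x i - x 1 - (real i - 1) / real n\<bar> powr a)"
    by (rule sum.cong) (auto simp: MV1_def algebra_simps)
  finally show ?thesis .
qed

end

theory Submission
  imports Defs
begin

text \<open>
  Since \<open>X\<^sub>i \<le> t\<close> iff at least \<open>i\<close> arrivals occurred by time \<open>t\<close>, the Poisson law of the
  count makes \<open>X\<^sub>i\<close> Erlang distributed with mean \<open>i/n\<close>, so its exponential moments are
  explicit. At \<open>\<theta> = \<plusminus>\<surd>n/2\<close> the moment of \<open>X\<^sub>i - i/n\<close> is at most \<open>exp (i / (2n)) \<le> exp (1/2)\<close>,
  so deviations of order \<open>1/\<surd>n\<close> have uniform exponential tails, and all their absolute moments
  follow. The displacement of sensor \<open>i\<close> is the difference of the deviations of \<open>X\<^sub>i\<close> and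
  \<open>X\<^sub>1\<close>, so it contributes \<open>O(n powr (-a/2))\<close>, uniformly in \<open>i \<le> n\<close>, without any use of the joint
  law of the arrival times.
\<close>

section \<open>Exponential moments of the Erlang distribution\<close>

text \<open>Exponential tilting: the weight only lowers the rate from \<open>l\<close> to
  \<open>l - \<theta>\<close>, so the moment generating function is the leftover constant, with no
  integral to compute.\<close>

lemma erlang_density_times_exp:
  assumes "\<theta> < l"
  shows "erlang_density k l x * exp (\<theta> * x) = (l / (l - \<theta>)) ^ Suc k * erlang_density k (l - \<theta>) x"
proof -
  have "exp (- (l * x)) * exp (\<theta> * x) = exp ((\<theta> - l) * x)"
    by (simp add: exp_add[symmetric] algebra_simps)
  with assms show ?thesis
    by (simp add: erlang_density_def power_divide divide_simps mult.assoc)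
qed

lemma (in prob_space) has_bochner_integral_erlang_exp:
  assumes D: "distributed M lborel X (erlang_density k l)" and l: "0 < l" and \<theta>: "\<theta> < l"
  shows "has_bochner_integral M (\<lambda>\<omega>. exp (\<theta> * X \<omega>)) ((l / (l - \<theta>)) ^ Suc k)"
proof (rule has_bochner_integral_nn_integral)
  have [measurable]: "random_variable borel X"
    using distributed_measurable[OF D] by simp
  show "(\<lambda>\<omega>. exp (\<theta> * X \<omega>)) \<in> borel_measurable M" by measurable
  show "AE \<omega> in M. 0 \<le> exp (\<theta> * X \<omega>)" by simp
  show c: "0 \<le> (l / (l - \<theta>)) ^ Suc k" using l \<theta> by (intro zero_le_power) simp
  have "(\<integral>\<^sup>+\<omega>. ennreal (exp (\<theta> * X \<omega>)) \<partial>M) =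
      (\<integral>\<^sup>+x. ennreal (erlang_density k l x) * ennreal (exp (\<theta> * x)) \<partial>lborel)"
    by (rule distributed_nn_integral[symmetric, OF D]) simp
  also have "\<dots> = (\<integral>\<^sup>+x. ennreal ((l / (l - \<theta>)) ^ Suc k) * ennreal (erlang_density k (l - \<theta>) x) \<partial>lborel)"
    using l \<theta> c
    by (intro nn_integral_cong)
       (simp only: ennreal_mult''[symmetric] erlang_density_times_exp exp_ge_zero erlang_density_nonneg
          less_imp_le diff_gt_0_iff_gt)
  also have "\<dots> = ennreal ((l / (l - \<theta>)) ^ Suc k) * (\<integral>\<^sup>+x. ennreal (erlang_density k (l - \<theta>) x) \<partial>lborel)"
    by (rule nn_integral_cmult) simp
  also have "(\<integral>\<^sup>+x. ennreal (erlang_density k (l - \<theta>) x) \<partial>lborel) = 1"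
    \<comment> \<open>The zeroth moment is the total mass; positivity of the tilted rate makes it
      1.\<close>
    using nn_integral_erlang_ith_moment[of "l - \<theta>" k 0] \<theta> by simp
  finally show "(\<integral>\<^sup>+\<omega>. ennreal (exp (\<theta> * X \<omega>)) \<partial>M) = ennreal ((l / (l - \<theta>)) ^ Suc k)" by simp
qed

text \<open>With \<open>x = \<theta> / l\<close> the centred moment is
  \<open>exp (- ln (1 - x) - x)\<close> to the power \<open>Suc k\<close>. Centring cancels the
  linear term of the logarithm, and the remainder is at most \<open>2 * x\<^sup>2\<close> because
  \<open>\<bar>x\<bar> \<le> 1/2\<close>.\<close>

lemma (in prob_space) erlang_exp_deviation:
  assumes D: "distributed M lborel X (erlang_density k l)" and l: "0 < l" and \<theta>: "\<bar>\<theta>\<bar> \<le> l / 2"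
  shows "integrable M (\<lambda>\<omega>. exp (\<theta> * (X \<omega> - real (Suc k) / l)))"
    and "expectation (\<lambda>\<omega>. exp (\<theta> * (X \<omega> - real (Suc k) / l))) \<le> exp (2 * real (Suc k) * (\<theta> / l)\<^sup>2)"
proof -
  have \<theta>l: "\<theta> < l" using l \<theta> by linarith
  let ?c = "exp (- (\<theta> * (real (Suc k) / l)))"
  have eq: "(\<lambda>\<omega>. exp (\<theta> * (X \<omega> - real (Suc k) / l))) = (\<lambda>\<omega>. exp (\<theta> * X \<omega>) * ?c)"
    by (simp add: exp_add[symmetric] right_diff_distrib)
  have B: "has_bochner_integral M (\<lambda>\<omega>. exp (\<theta> * (X \<omega> - real (Suc k) / l))) ((l / (l - \<theta>)) ^ Suc k * ?c)"
    unfolding eq by (intro has_bochner_integral_mult_left has_bochner_integral_erlang_exp[OF D l \<theta>l])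
  show "integrable M (\<lambda>\<omega>. exp (\<theta> * (X \<omega> - real (Suc k) / l)))"
    using B by (rule integrable.intros)
  define x where "x = \<theta> / l"
  have x: "\<bar>- x\<bar> \<le> 1/2" "x < 1" using \<theta> \<theta>l l by (auto simp: x_def field_simps abs_le_iff)
  have "- ln (1 - x) - x \<le> 2 * x\<^sup>2"
    using abs_ln_one_plus_x_minus_x_bound[OF x(1)] by (simp add: abs_le_iff)
  then have "real (Suc k) * (- ln (1 - x) - x) \<le> real (Suc k) * (2 * x\<^sup>2)"
    by (rule mult_left_mono) simp
  then have *: "exp (real (Suc k) * (- ln (1 - x) - x)) \<le> exp (2 * real (Suc k) * x\<^sup>2)"
    by (simp add: algebra_simps)
  have "l / (l - \<theta>) = inverse (1 - x)" using l \<theta>l by (simp add: x_def field_simps)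
  also have "\<dots> = exp (- ln (1 - x))" using x by (simp add: exp_minus)
  finally have "(l / (l - \<theta>)) ^ Suc k * ?c = exp (real (Suc k) * (- ln (1 - x) - x))"
    by (simp only: exp_of_nat_mult[symmetric] exp_add[symmetric])
       (simp add: x_def algebra_simps add_divide_distrib)
  with * B show "expectation (\<lambda>\<omega>. exp (\<theta> * (X \<omega> - real (Suc k) / l))) \<le> exp (2 * real (Suc k) * (\<theta> / l)\<^sup>2)"
    by (simp add: has_bochner_integral_iff x_def)
qed

section \<open>Arrival times and their Erlang law\<close>

context poisson_process
begin

text \<open>Clipping at 0 removes the side condition on \<open>t\<close>, so the rule also applies
  at the negative levels met in the measurability of arrival times.\<close>

lemma measurable_count_max [measurable]: "N (max t 0) \<in> measurable M (count_space UNIV)"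
  by (rule measurable_count) simp

lemma prob_count_le:
  assumes "0 \<le> t"
  shows "prob {\<omega> \<in> space M. N t \<omega> \<le> k} = (\<Sum>j\<le>k. (rate * t) ^ j * exp (- rate * t) / fact j)"
proof (cases "t = 0")
  \<comment> \<open>The law of increments covers only intervals of positive length. At time 0 the
    sum reduces to its term \<open>j = 0\<close>, where the power of 0 equals 1.\<close>
  case True
  have "(\<Sum>j\<le>k. (0::real) ^ j / fact j) = 1"
    by (simp add: power_0_left if_distrib[where f="\<lambda>x. x / a" for a] sum.If_cases)
  with True count_0 prob_space show ?thesis by (simp cong: conj_cong)
next
  case False
  with assms have t: "0 < t" by simp
  have [measurable]: "N t \<in> measurable M (count_space UNIV)" using assms by (rule measurable_count)
  have "distr M (count_space UNIV) (N t) = distr M (count_space UNIV) (\<lambda>\<omega>. N t \<omega> - N 0 \<omega>)"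
    using count_0 by (intro distr_cong) auto
  also have "\<dots> = measure_pmf (poisson_pmf (rate * t))"
    using poisson_increments[of 0 t] t by simp
  finally have d: "distr M (count_space UNIV) (N t) = measure_pmf (poisson_pmf (rate * t))" .
  have "prob {\<omega> \<in> space M. N t \<omega> \<le> k} = measure (distr M (count_space UNIV) (N t)) {..k}"
    by (subst measure_distr) (auto intro!: arg_cong[where f=prob])
  also have "\<dots> = (\<Sum>j\<le>k. pmf (poisson_pmf (rate * t)) j)"
    unfolding d by (rule measure_measure_pmf_finite) simp
  finally show ?thesis using t rate_pos by (simp add: mult.commute)
qed

text \<open>Almost surely the set defining an arrival time is nonempty: the Poisson probability of
  at most \<open>k\<close> arrivals is a polynomial in time against a decaying exponential, so it
  vanishes in the limit.\<close>

lemma AE_exists_count_ge: "AE \<omega> in M. \<exists>m::nat. k < N (real m) \<omega>"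
proof -
  have [measurable]: "N (real m) \<in> measurable M (count_space UNIV)" for m
    by (rule measurable_count) simp
  let ?B = "{\<omega> \<in> space M. \<forall>m::nat. N (real m) \<omega> \<le> k}"
  have "((\<lambda>x::real. \<Sum>j\<le>k. (x ^ j / exp x) / fact j) \<longlongrightarrow> (\<Sum>j\<le>k. 0 / fact j)) at_top"
    by (intro tendsto_intros tendsto_power_div_exp_0) simp
  moreover have "filterlim (\<lambda>m. rate * real m) at_top sequentially"
    using rate_pos by (intro filterlim_tendsto_pos_mult_at_top[OF tendsto_const _ filterlim_real_sequentially])
  ultimately have "(\<lambda>m. \<Sum>j\<le>k. ((rate * real m) ^ j / exp (rate * real m)) / fact j) \<longlonglongrightarrow> (\<Sum>j\<le>k. 0 / fact j)"
    by (rule filterlim_compose)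
  then have "(\<lambda>m. prob {\<omega> \<in> space M. N (real m) \<omega> \<le> k}) \<longlonglongrightarrow> 0"
    by (simp add: prob_count_le exp_minus field_simps)
  moreover have "prob ?B \<le> prob {\<omega> \<in> space M. N (real m) \<omega> \<le> k}" for m
    by (rule finite_measure_mono) auto
  ultimately have "prob ?B \<le> 0"
    by (intro LIMSEQ_le_const) auto
  then have "prob ?B = 0" by (simp add: order_antisym)
  then show ?thesis
    by (intro AE_I[where N="?B"]) (auto simp: emeasure_eq_measure not_less)
qed

lemma arrival_time_nonneg:
  assumes "0 \<le> s" "i \<le> N s \<omega>"
  shows "0 \<le> arrival_time N i \<omega>"
  unfolding arrival_time_def using assms by (intro cInf_greatest) auto

text \<open>The forward direction says that the infimum is attained, which rests on right
  continuity. The arrivals by time \<open>s\<close> keep the infimum from ranging over the empty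
  set.\<close>

lemma arrival_time_le_iff:
  assumes \<omega>: "\<omega> \<in> space M" and s: "0 \<le> s" "i \<le> N s \<omega>" and t: "0 \<le> t"
  shows "arrival_time N i \<omega> \<le> t \<longleftrightarrow> i \<le> N t \<omega>"
proof
  assume "i \<le> N t \<omega>"
  with t show "arrival_time N i \<omega> \<le> t"
    unfolding arrival_time_def by (intro cInf_lower) (auto intro: bdd_belowI[of _ 0])
next
  assume le: "arrival_time N i \<omega> \<le> t"
  show "i \<le> N t \<omega>"
  proof (rule ccontr)
    assume neg: "\<not> i \<le> N t \<omega>"
    have "((\<lambda>u. N u \<omega>) \<longlongrightarrow> N t \<omega>) (at_right t)"
      using right_continuous_paths[OF \<omega> t] by (simp add: continuous_within)
    \<comment> \<open>In the discrete space of naturals, convergence means being eventually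
      constant, so the count stays below \<open>i\<close> on a whole interval after
      \<open>t\<close>.\<close>
    then have "eventually (\<lambda>u. N u \<omega> = N t \<omega>) (at_right t)"
      by (simp add: tendsto_discrete)
    then obtain b where b: "t < b" "\<And>u. t < u \<Longrightarrow> u < b \<Longrightarrow> N u \<omega> = N t \<omega>"
      by (auto simp: eventually_at_right_field)
    have "b \<le> u" if u: "0 \<le> u" "i \<le> N u \<omega>" for u
    proof (rule ccontr)
      assume "\<not> b \<le> u"
      then have "N u \<omega> \<le> N t \<omega>"
        using b(2)[of u] mono_paths[OF \<omega> u(1), of t] by (cases "u \<le> t") auto
      with u neg show False by simp
    qed
    then have "b \<le> arrival_time N i \<omega>"
      unfolding arrival_time_def using s by (intro cInf_greatest) auto
    with le b show False by simp
  qed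
qed

text \<open>Measurability is needed on every path, including those with too few arrivals. There the
  value is the fixed real \<open>Inf {}\<close>, and a countable quantifier over integer times
  separates the two cases.\<close>

lemma borel_measurable_arrival_time [measurable]: "arrival_time N i \<in> borel_measurable M"
proof (subst borel_measurable_iff_le, rule allI)
  fix t :: real
  have [measurable]: "N (real m) \<in> measurable M (count_space UNIV)" for m
    by (rule measurable_count) simp
  have "arrival_time N i \<omega> \<le> t \<longleftrightarrow>
      (if \<exists>m::nat. i \<le> N (real m) \<omega> then 0 \<le> t \<and> i \<le> N (max t 0) \<omega> else Inf {} \<le> t)"
    if \<omega>: "\<omega> \<in> space M" for \<omega>
  proof (cases "\<exists>m::nat. i \<le> N (real m) \<omega>")
    case True
    then obtain m :: nat where m: "i \<le> N (real m) \<omega>" ..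
    show ?thesis
      using True arrival_time_nonneg[OF _ m] arrival_time_le_iff[OF \<omega> _ m, of t]
      by (cases "0 \<le> t") (auto simp: max_def)
  next
    case False
    \<comment> \<open>By monotonicity, rounding a time up to an integer loses no arrivals.\<close>
    have "i \<le> N (real (nat \<lceil>u\<rceil>)) \<omega>" if "0 \<le> u" "i \<le> N u \<omega>" for u
      using mono_paths[OF \<omega> that(1), of "real (nat \<lceil>u\<rceil>)"] that by linarith
    with False have "{u. 0 \<le> u \<and> i \<le> N u \<omega>} = {}" by blast
    with False show ?thesis by (simp only: arrival_time_def if_False)
  qed
  then have "{\<omega> \<in> space M. arrival_time N i \<omega> \<le> t} = {\<omega> \<in> space M.
      if \<exists>m::nat. i \<le> N (real m) \<omega> then 0 \<le> t \<and> i \<le> N (max t 0) \<omega> else Inf {} \<le> t}"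
    by (simp cong: conj_cong)
  also have "\<dots> \<in> sets M" by measurable
  finally show "{\<omega> \<in> space M. arrival_time N i \<omega> \<le> t} \<in> sets M" .
qed

text \<open>Arrival number \<open>Suc k\<close> comes after \<open>t\<close> exactly when at most
  \<open>k\<close> arrivals occurred by then, almost surely; the Poisson sum for that event is the
  complement of the Erlang CDF.\<close>

lemma distributed_arrival_time:
  "distributed M lborel (arrival_time N (Suc k)) (erlang_density k rate)"
proof (subst erlang_distributed_iff[OF rate_pos], intro conjI allI impI)
  fix t :: real assume t: "0 \<le> t"
  have [measurable]: "N t \<in> measurable M (count_space UNIV)" using t by (rule measurable_count)
  have "AE \<omega> in M. arrival_time N (Suc k) \<omega> \<le> t \<longleftrightarrow> Suc k \<le> N t \<omega>"
    using AE_exists_count_ge[of k] AE_space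
  proof eventually_elim
    case (elim \<omega>)
    then obtain m :: nat where "Suc k \<le> N (real m) \<omega>" by (auto simp: Suc_le_eq)
    with arrival_time_le_iff[OF elim(2) _ this t] show ?case by simp
  qed
  then have "\<P>(\<omega> in M. arrival_time N (Suc k) \<omega> \<le> t) = \<P>(\<omega> in M. \<not> N t \<omega> \<le> k)"
    by (intro finite_measure_eq_AE) (auto simp: Suc_le_eq not_le)
  also have "\<dots> = 1 - \<P>(\<omega> in M. N t \<omega> \<le> k)"
    by (rule prob_neg) measurable
  also have "\<dots> = erlang_CDF k rate t"
    using t by (simp add: prob_count_le erlang_CDF_def)
  finally show "\<P>(\<omega> in M. arrival_time N (Suc k) \<omega> \<le> t) = erlang_CDF k rate t" .
qed (use rate_pos in auto)

lemma arrival_time_exp_deviation: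
  assumes "1 \<le> i" "real i \<le> rate" "1 \<le> rate" "\<bar>\<theta>\<bar> = sqrt rate / 2"
  shows "integrable M (\<lambda>\<omega>. exp (\<theta> * (arrival_time N i \<omega> - real i / rate)))"
    and "expectation (\<lambda>\<omega>. exp (\<theta> * (arrival_time N i \<omega> - real i / rate))) \<le> exp (1 / 2)"
proof -
  obtain k where i: "i = Suc k" using assms(1) by (cases i) auto
  \<comment> \<open>Here \<open>1 \<le> rate\<close> enters: it brings \<open>\<theta>\<close> into
    the range of the Erlang bound.\<close>
  have "sqrt rate \<le> rate"
    using assms(3) by (simp add: real_le_lsqrt power2_eq_square)
  then have \<theta>: "\<bar>\<theta>\<bar> \<le> rate / 2" using assms(4) by simp
  note * = erlang_exp_deviation[OF distributed_arrival_time rate_pos \<theta>, of k, folded i]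
  show "integrable M (\<lambda>\<omega>. exp (\<theta> * (arrival_time N i \<omega> - real i / rate)))" by (rule *)
  have "\<theta>\<^sup>2 = (sqrt rate / 2)\<^sup>2" using assms(4) by (metis power2_abs)
  also have "\<dots> = rate / 4" using rate_pos by (simp add: power_divide)
  finally have "(\<theta> / rate)\<^sup>2 = rate / 4 / rate\<^sup>2" by (simp only: power_divide)
  also have "\<dots> = 1 / (4 * rate)" using rate_pos by (simp add: power2_eq_square)
  finally have "(\<theta> / rate)\<^sup>2 = 1 / (4 * rate)" .
  then have "2 * real i * (\<theta> / rate)\<^sup>2 \<le> 1 / 2"
    using assms(2) rate_pos by (simp add: field_simps)
  with *(2) show "expectation (\<lambda>\<omega>. exp (\<theta> * (arrival_time N i \<omega> - real i / rate))) \<le> exp (1 / 2)"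
    by (meson exp_le_cancel_iff order_trans)
qed

end

section \<open>From exponential moments to absolute moments\<close>

text \<open>The inequality \<open>ln v \<le> v - 1\<close> at \<open>v = u / a\<close>, multiplied
  by \<open>a\<close> and exponentiated.\<close>

lemma powr_le_exp:
  fixes a u :: real
  assumes "0 < a" "0 \<le> u"
  shows "u powr a \<le> a powr a * exp u"
proof (cases "u = 0")
  case False
  with assms have u: "0 < u" by simp
  have "ln (u / a) \<le> u / a" using u assms ln_le_minus_one[of "u / a"] by simp
  then have "a * ln (u / a) \<le> u" using assms by (simp add: field_simps)
  then have "(u / a) powr a \<le> exp u" using u assms by (simp add: powr_def)
  then show ?thesis using u assms by (simp add: powr_divide field_simps)
qed (use assms in simp)

text \<open>
  The four exponentials on the right split the one of \<open>r * \<bar>y - z\<bar>\<close> by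
  \<open>r * \<bar>y - z\<bar> \<le> max (2 * r * \<bar>y\<bar>) (2 * r * \<bar>z\<bar>)\<close>.
\<close>

lemma abs_diff_powr_le_exp:
  fixes a r y z :: real
  assumes a: "0 < a" and r: "0 < r"
  shows "\<bar>y - z\<bar> powr a \<le> (a / r) powr a *
    (exp (2 * r * y) + exp (- (2 * r) * y) + exp (2 * r * z) + exp (- (2 * r) * z))"
proof -
  have "r * \<bar>y - z\<bar> \<le> 2 * r * \<bar>y\<bar> \<or> r * \<bar>y - z\<bar> \<le> 2 * r * \<bar>z\<bar>"
  proof -
    have "\<bar>y - z\<bar> \<le> 2 * \<bar>y\<bar> \<or> \<bar>y - z\<bar> \<le> 2 * \<bar>z\<bar>" by linarith
    then show ?thesis using r by auto
  qed
  then have "r * \<bar>y - z\<bar> \<le> 2 * r * y \<or> r * \<bar>y - z\<bar> \<le> - (2 * r) * y \<or>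
      r * \<bar>y - z\<bar> \<le> 2 * r * z \<or> r * \<bar>y - z\<bar> \<le> - (2 * r) * z"
    by (auto simp: abs_if split: if_splits)
  then have "exp (r * \<bar>y - z\<bar>) \<le>
      exp (2 * r * y) + exp (- (2 * r) * y) + exp (2 * r * z) + exp (- (2 * r) * z)" (is "_ \<le> ?S")
    by (smt (verit) exp_ge_zero exp_le_cancel_iff)
  then have "a powr a * exp (r * \<bar>y - z\<bar>) \<le> a powr a * ?S"
    by (rule mult_left_mono) simp
  with powr_le_exp[OF a, of "r * \<bar>y - z\<bar>"] r
  have "(r * \<bar>y - z\<bar>) powr a \<le> a powr a * ?S" by simp
  then show ?thesis using a r by (simp add: powr_mult powr_divide field_simps)
qed

lemma (in poisson_process) MV1_displacement:
  fixes i n :: nat and a :: real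
  assumes a: "0 < a" and i: "1 \<le> i" "i \<le> n" and n: "rate = real n"
  defines "Z \<equiv> (\<lambda>\<omega>. \<bar>arrival_time N i \<omega> - arrival_time N 1 \<omega> - (real i - 1) / real n\<bar> powr a)"
  shows "integrable M Z"
    and "expectation Z \<le> (4 * a) powr a * (4 * exp (1 / 2)) * real n powr (- a / 2)"
proof -
  define Y where "Y j \<omega> = arrival_time N j \<omega> - real j / rate" for j \<omega>
  \<comment> \<open>Chosen so that the exponents \<open>2 * r\<close> and \<open>- (2 * r)\<close>
    are the two values \<open>sqrt rate / 2\<close> and \<open>- sqrt rate / 2\<close> at which
    moments are bounded.\<close>
  define r where "r = sqrt rate / 4"
  have r: "0 < r" using rate_pos by (simp add: r_def)
  have n1: "1 \<le> n" using i by simp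
  let ?E = "\<lambda>\<omega>. exp (2 * r * Y i \<omega>) + exp (- (2 * r) * Y i \<omega>) + exp (2 * r * Y 1 \<omega>) + exp (- (2 * r) * Y 1 \<omega>)"
  have [measurable]: "Z \<in> borel_measurable M" unfolding Z_def by measurable
  \<comment> \<open>The prescribed spacing is exactly the difference of the means
    \<open>i / n\<close> and \<open>1 / n\<close>.\<close>
  have "arrival_time N i \<omega> - arrival_time N 1 \<omega> - (real i - 1) / real n = Y i \<omega> - Y 1 \<omega>" for \<omega>
    using rate_pos by (simp add: Y_def n field_simps)
  then have le: "Z \<omega> \<le> (a / r) powr a * ?E \<omega>" for \<omega>
    using abs_diff_powr_le_exp[OF a r, of "Y i \<omega>" "Y 1 \<omega>"] by (simp add: Z_def)
  have *: "integrable M (\<lambda>\<omega>. exp (\<theta> * Y j \<omega>)) \<and> expectation (\<lambda>\<omega>. exp (\<theta> * Y j \<omega>)) \<le> exp (1 / 2)"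
    if "1 \<le> j" "j \<le> n" "\<bar>\<theta>\<bar> = 2 * r" for j \<theta>
    using arrival_time_exp_deviation[of j \<theta>] that n1 by (simp add: Y_def n r_def)
  note b = *[OF i, of "2 * r"] *[OF i, of "- (2 * r)"] *[OF order_refl n1, of "2 * r"] *[OF order_refl n1, of "- (2 * r)"]
  have intE: "integrable M (\<lambda>\<omega>. (a / r) powr a * ?E \<omega>)"
    using b r by (intro integrable_mult_right Bochner_Integration.integrable_add) simp_all
  show int: "integrable M Z"
    using intE by (rule Bochner_Integration.integrable_bound) (use le in \<open>auto intro!: AE_I2 order_trans[OF _ abs_ge_self] simp: Z_def\<close>)
  have "expectation Z \<le> expectation (\<lambda>\<omega>. (a / r) powr a * ?E \<omega>)"
    using int intE le by (rule integral_mono)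
  also have "\<dots> = (a / r) powr a * expectation ?E" by simp
  also have "\<dots> \<le> (a / r) powr a * (4 * exp (1 / 2))"
    using b r by (intro mult_left_mono) simp_all
  \<comment> \<open>Since \<open>a / r = 4 * a / sqrt n\<close>, the whole dependence on
    \<open>n\<close> sits in this factor.\<close>
  also have "(a / r) powr a = (4 * a) powr a * real n powr (- a / 2)"
    using a n1 by (simp add: r_def n powr_divide powr_half_sqrt[symmetric] powr_powr powr_minus field_simps)
  finally show "expectation Z \<le> (4 * a) powr a * (4 * exp (1 / 2)) * real n powr (- a / 2)"
    by (simp add: mult_ac)
qed

section \<open>Summation over the sensors\<close>

theorem theorem3:
  fixes a :: real
    and M :: "nat \<Rightarrow> 'a measure"
    and N :: "nat \<Rightarrow> real \<Rightarrow> 'a \<Rightarrow> nat"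
    and X :: "nat \<Rightarrow> nat \<Rightarrow> 'a \<Rightarrow> real"
  assumes "a > 0"
    and "\<And>n. n \<ge> 1 \<Longrightarrow> poisson_process (M n) (real n) (N n)"
    and "\<And>n i \<omega>. X n i \<omega> = arrival_time (N n) i \<omega>"
  shows "(\<forall>n\<ge>1. integrable (M n)
            (\<lambda>\<omega>. total_movement a n (\<lambda>i. X n i \<omega>) (MV1 (1 / real n) (\<lambda>i. X n i \<omega>)))) \<and>
         (\<lambda>n. prob_space.expectation (M n)
            (\<lambda>\<omega>. total_movement a n (\<lambda>i. X n i \<omega>) (MV1 (1 / real n) (\<lambda>i. X n i \<omega>))))
           \<in> O(\<lambda>n. real n powr (1 - a / 2))"
proof -
  define C where "C = (4 * a) powr a * (4 * exp (1 / 2))"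
  let ?T = "\<lambda>n \<omega>. total_movement a n (\<lambda>i. X n i \<omega>) (MV1 (1 / real n) (\<lambda>i. X n i \<omega>))"
  have main: "integrable (M n) (?T n) \<and> 0 \<le> integral\<^sup>L (M n) (?T n) \<and>
      integral\<^sup>L (M n) (?T n) \<le> C * real n powr (1 - a / 2)" if n: "1 \<le> n" for n
  proof -
    interpret poisson_process "M n" "real n" "N n" using n by (rule assms(2))
    let ?Z = "\<lambda>i \<omega>. \<bar>X n i \<omega> - X n 1 \<omega> - (real i - 1) / real n\<bar> powr a"
    have T: "?T n = (\<lambda>\<omega>. \<Sum>i=2..n. ?Z i \<omega>)" by (simp add: total_movement_MV1)
    have Z: "integrable (M n) (?Z i)" "expectation (?Z i) \<le> C * real n powr (- a / 2)"
      if "i \<in> {2..n}" for i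
      using MV1_displacement[OF assms(1), of i n] that by (simp_all add: assms(3) C_def)
    have "expectation (?T n) = (\<Sum>i=2..n. expectation (?Z i))"
      unfolding T by (rule Bochner_Integration.integral_sum) (rule Z)
    also have "\<dots> \<le> (\<Sum>i=2..n. C * real n powr (- a / 2))"
      by (rule sum_mono) (rule Z)
    \<comment> \<open>There are \<open>n - 1\<close> equal summands, and \<open>C\<close> is
      nonnegative.\<close>
    also have "\<dots> \<le> real n * (C * real n powr (- a / 2))"
      by (simp, intro mult_right_mono) (auto simp: C_def)
    also have "\<dots> = C * real n powr (1 - a / 2)"
      using powr_mult_base[of "real n" "- a / 2"] by (simp add: mult.left_commute)
    finally have "expectation (?T n) \<le> C * real n powr (1 - a / 2)" .
    moreover have "integrable (M n) (?T n)"
      unfolding T by (rule Bochner_Integration.integrable_sum) (rule Z)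
    moreover have "0 \<le> expectation (?T n)"
      unfolding T by (intro Bochner_Integration.integral_nonneg sum_nonneg) simp
    ultimately show ?thesis by simp
  qed
  \<comment> \<open>Nonnegativity of the expectation removes the norm; starting at 1 skips
    \<open>n = 0\<close>, where no process is assumed.\<close>
  then have "eventually (\<lambda>n. norm (integral\<^sup>L (M n) (?T n)) \<le> C * norm (real n powr (1 - a / 2))) at_top"
    by (intro eventually_at_top_linorderI[of 1]) simp
  then have "(\<lambda>n. integral\<^sup>L (M n) (?T n)) \<in> O(\<lambda>n. real n powr (1 - a / 2))"
    by (rule bigoI)
  with main show ?thesis by blast
qed

end
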